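(* Let $\mathcal{A}$ and $\mathcal{B}$ be monoidal categories with unit objects $\mathbb{I}_{\mathcal{A}}$ and $\mathbb{I}_{\mathcal{B}}$, and let $(L,R)$ be an adjunction ($L:\mathcal{B}\to\mathcal{A}$ left adjoint to $R:\mathcal{A}\to\mathcal{B}$) such that $L$ is strong monoidal. If $\mathcal{A}$ is pre-rigid, then for every object $B$ of $\mathcal{B}$ the presheaf $\mathrm{Hom}_{\mathcal{B}}(-\otimes B, RL(\mathbb{I}_{\mathcal{B}})):\mathcal{B}^{\mathrm{op}}\to\mathsf{Set}$ is representable. If furthermore $\mathbb{I}_{\mathcal{B}}\cong RL(\mathbb{I}_{\mathcal{B}})$ (for example, if $L$ is fully faithful), then $\mathcal{B}$ is pre-rigid too.
   Context: A monoidal category $(\mathcal{C},\otimes,\mathbb{I})$ is (right) pre-rigid if for every object $X$ there are an object $X^*$ (a pre-dual of $X$) and a morphism $\mathrm{ev}_X:X^*\otimes X\to\mathbb{I}$ such that for every object $T$ the map $\mathrm{Hom}_{\mathcal{C}}(T,X^* )\to\mathrm{Hom}_{\mathcal{C}}(T\otimes X,\mathbb{I})$, $u\mapsto \mathrm{ev}_X\circ(u\otimes X)$, is bijective. Here $X$ also denotes the identity morphism of $X$. No braiding is assumed. *)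

theory Defs
  imports "HOL-Library.FuncSet"
begin

section \<open>Categories\<close>

text \<open>Composition is written in the usual (applicative) order: \<open>g \<cdot> f\<close> is \<open>g\<close> after \<open>f\<close>.
  The operations are total functions on the underlying types; only their values on objects,
  respectively composable arrows, matter.\<close>

record ('o, 'm) cat =
  Ob :: "'o set"
  Ar :: "'m set"
  Dom :: "'m \<Rightarrow> 'o"
  Cod :: "'m \<Rightarrow> 'o"
  Idn :: "'o \<Rightarrow> 'm" ("\<one>\<index>")
  Comp :: "'m \<Rightarrow> 'm \<Rightarrow> 'm" (infixr "\<cdot>\<index>" 75)

definition hom :: "('o, 'm, 'x) cat_scheme \<Rightarrow> 'o \<Rightarrow> 'o \<Rightarrow> 'm set" where
  "hom C X Y = {f \<in> Ar C. Dom C f = X \<and> Cod C f = Y}"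

locale category =
  fixes C :: "('o, 'm, 'x) cat_scheme" (structure)
  assumes dom_ob: "f \<in> Ar C \<Longrightarrow> Dom C f \<in> Ob C"
    and cod_ob: "f \<in> Ar C \<Longrightarrow> Cod C f \<in> Ob C"
    and id_hom: "X \<in> Ob C \<Longrightarrow> \<one> X \<in> hom C X X"
    and comp_hom: "\<lbrakk>f \<in> hom C X Y; g \<in> hom C Y Z\<rbrakk> \<Longrightarrow> g \<cdot> f \<in> hom C X Z"
    and comp_id_left: "f \<in> hom C X Y \<Longrightarrow> \<one> Y \<cdot> f = f"
    and comp_id_right: "f \<in> hom C X Y \<Longrightarrow> f \<cdot> \<one> X = f"
    and comp_assoc: "\<lbrakk>f \<in> hom C W X; g \<in> hom C X Y; h \<in> hom C Y Z\<rbrakk>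
      \<Longrightarrow> (h \<cdot> g) \<cdot> f = h \<cdot> (g \<cdot> f)"

definition is_iso :: "('o, 'm, 'x) cat_scheme \<Rightarrow> 'm \<Rightarrow> bool" where
  "is_iso C f \<longleftrightarrow> f \<in> Ar C \<and>
    (\<exists>g \<in> hom C (Cod C f) (Dom C f).
      g \<cdot>\<^bsub>C\<^esub> f = \<one>\<^bsub>C\<^esub> (Dom C f) \<and> f \<cdot>\<^bsub>C\<^esub> g = \<one>\<^bsub>C\<^esub> (Cod C f))"

definition isomorphic :: "('o, 'm, 'x) cat_scheme \<Rightarrow> 'o \<Rightarrow> 'o \<Rightarrow> bool" where
  "isomorphic C X Y \<longleftrightarrow> (\<exists>f \<in> hom C X Y. is_iso C f)"

definition op_cat :: "('o, 'm, 'x) cat_scheme \<Rightarrow> ('o, 'm) cat" where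
  "op_cat C = \<lparr>Ob = Ob C, Ar = Ar C, Dom = Cod C, Cod = Dom C, Idn = Idn C,
    Comp = (\<lambda>g f. f \<cdot>\<^bsub>C\<^esub> g)\<rparr>"

text \<open>The category of sets whose elements are drawn from a fixed type. An arrow records its
  domain and codomain, and its underlying function is extensional (\<open>undefined\<close> outside
  the domain), so that arrows with the same domain, codomain and values are equal.\<close>

type_synonym 'a set_arrow = "'a set \<times> ('a \<Rightarrow> 'a) \<times> 'a set"

definition set_cat :: "('a set, 'a set_arrow) cat" where
  "set_cat = \<lparr>Ob = UNIV, Ar = {(S, f, T). f \<in> S \<rightarrow>\<^sub>E T},
    Dom = (\<lambda>(S, f, T). S), Cod = (\<lambda>(S, f, T). T),
    Idn = (\<lambda>S. (S, \<lambda>x\<in>S. x, S)),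
    Comp = (\<lambda>(_, g, U) (S, f, _). (S, compose S g f, U))\<rparr>"


section \<open>Functors, natural transformations, adjunctions\<close>

record ('o, 'm, 'p, 'n) func =
  OMap :: "'o \<Rightarrow> 'p"
  AMap :: "'m \<Rightarrow> 'n"

locale cat_functor = source: category C + target: category D
  for C :: "('o, 'm, 'x) cat_scheme" and D :: "('p, 'n, 'y) cat_scheme" +
  fixes F :: "('o, 'm, 'p, 'n) func"
  assumes omap_ob: "X \<in> Ob C \<Longrightarrow> OMap F X \<in> Ob D"
    and amap_hom: "f \<in> hom C X Y \<Longrightarrow> AMap F f \<in> hom D (OMap F X) (OMap F Y)"
    and amap_id: "X \<in> Ob C \<Longrightarrow> AMap F (\<one>\<^bsub>C\<^esub> X) = \<one>\<^bsub>D\<^esub> (OMap F X)"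
    and amap_comp: "\<lbrakk>f \<in> hom C X Y; g \<in> hom C Y Z\<rbrakk>
      \<Longrightarrow> AMap F (g \<cdot>\<^bsub>C\<^esub> f) = AMap F g \<cdot>\<^bsub>D\<^esub> AMap F f"

definition id_func :: "('o, 'm, 'o, 'm) func" where
  "id_func = \<lparr>OMap = (\<lambda>X. X), AMap = (\<lambda>f. f)\<rparr>"

definition comp_func ::
    "('p, 'n, 'q, 'k) func \<Rightarrow> ('o, 'm, 'p, 'n) func \<Rightarrow> ('o, 'm, 'q, 'k) func" where
  "comp_func G F = \<lparr>OMap = OMap G \<circ> OMap F, AMap = AMap G \<circ> AMap F\<rparr>"

definition fully_faithful ::
    "('o, 'm, 'x) cat_scheme \<Rightarrow> ('p, 'n, 'y) cat_scheme \<Rightarrow> ('o, 'm, 'p, 'n) func \<Rightarrow> bool" where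
  "fully_faithful C D F \<longleftrightarrow>
    (\<forall>X \<in> Ob C. \<forall>Y \<in> Ob C. bij_betw (AMap F) (hom C X Y) (hom D (OMap F X) (OMap F Y)))"

locale nat_transformation = F: cat_functor C D F + G: cat_functor C D G
  for C :: "('o, 'm, 'x) cat_scheme" and D :: "('p, 'n, 'y) cat_scheme"
    and F G :: "('o, 'm, 'p, 'n) func" +
  fixes \<tau> :: "'o \<Rightarrow> 'n"
  assumes component_hom: "X \<in> Ob C \<Longrightarrow> \<tau> X \<in> hom D (OMap F X) (OMap G X)"
    and naturality: "f \<in> hom C X Y \<Longrightarrow> \<tau> Y \<cdot>\<^bsub>D\<^esub> AMap F f = AMap G f \<cdot>\<^bsub>D\<^esub> \<tau> X"

locale nat_isomorphism = nat_transformation +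
  assumes component_iso: "X \<in> Ob C \<Longrightarrow> is_iso D (\<tau> X)"

locale adjunction =
  left: cat_functor B A L + right: cat_functor A B R +
  unit: nat_transformation B B id_func "comp_func R L" \<eta> +
  counit: nat_transformation A A "comp_func L R" id_func \<epsilon>
  for B :: "('p, 'n, 'y) cat_scheme" and A :: "('o, 'm, 'x) cat_scheme"
    and L :: "('p, 'n, 'o, 'm) func" and R :: "('o, 'm, 'p, 'n) func"
    and \<eta> :: "'p \<Rightarrow> 'n" and \<epsilon> :: "'o \<Rightarrow> 'm" +
  assumes triangle_left: "Y \<in> Ob B \<Longrightarrow> \<epsilon> (OMap L Y) \<cdot>\<^bsub>A\<^esub> AMap L (\<eta> Y) = \<one>\<^bsub>A\<^esub> (OMap L Y)"
    and triangle_right: "X \<in> Ob A \<Longrightarrow> AMap R (\<epsilon> X) \<cdot>\<^bsub>B\<^esub> \<eta> (OMap R X) = \<one>\<^bsub>B\<^esub> (OMap R X)"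


section \<open>Representable presheaves\<close>

text \<open>The contravariant functor \<open>Hom(-, Z)\<close>. Since every hom-set of \<open>C\<close> consists of elements
  of the type \<open>'m\<close>, it takes values in \<open>set_cat\<close> over that type.\<close>

definition hom_presheaf ::
    "('o, 'm, 'x) cat_scheme \<Rightarrow> 'o \<Rightarrow> ('o, 'm, 'm set, 'm set_arrow) func" where
  "hom_presheaf C Z = \<lparr>OMap = (\<lambda>T. hom C T Z),
    AMap = (\<lambda>f. (hom C (Cod C f) Z, \<lambda>h \<in> hom C (Cod C f) Z. h \<cdot>\<^bsub>C\<^esub> f, hom C (Dom C f) Z))\<rparr>"

definition representable ::
    "('o, 'm, 'x) cat_scheme \<Rightarrow> ('o, 'm, 'm set, 'm set_arrow) func \<Rightarrow> bool" where
  "representable C P \<longleftrightarrow>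
    (\<exists>X \<in> Ob C. \<exists>\<tau>. nat_isomorphism (op_cat C) set_cat (hom_presheaf C X) P \<tau>)"


section \<open>Monoidal categories\<close>

text \<open>The tensor product is written \<open>\<otimes>\<close> on objects and \<open>\<boxtimes>\<close> on arrows.\<close>

record ('o, 'm) moncat = "('o, 'm) cat" +
  TensorO :: "'o \<Rightarrow> 'o \<Rightarrow> 'o" (infixr "\<otimes>\<index>" 80)
  TensorA :: "'m \<Rightarrow> 'm \<Rightarrow> 'm" (infixr "\<boxtimes>\<index>" 80)
  UnitO :: "'o" ("\<I>\<index>")
  Assoc :: "'o \<Rightarrow> 'o \<Rightarrow> 'o \<Rightarrow> 'm" ("\<a>\<index>")
  LUnit :: "'o \<Rightarrow> 'm" ("\<l>\<index>")
  RUnit :: "'o \<Rightarrow> 'm" ("\<r>\<index>")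

locale monoidal_category = category C
  for C :: "('o, 'm, 'x) moncat_scheme" (structure) +
  assumes unit_ob: "\<I> \<in> Ob C"
    and tensor_ob: "\<lbrakk>X \<in> Ob C; Y \<in> Ob C\<rbrakk> \<Longrightarrow> X \<otimes> Y \<in> Ob C"
    and tensor_hom: "\<lbrakk>f \<in> hom C X X'; g \<in> hom C Y Y'\<rbrakk> \<Longrightarrow> f \<boxtimes> g \<in> hom C (X \<otimes> Y) (X' \<otimes> Y')"
    and tensor_id: "\<lbrakk>X \<in> Ob C; Y \<in> Ob C\<rbrakk> \<Longrightarrow> \<one> X \<boxtimes> \<one> Y = \<one> (X \<otimes> Y)"
    and tensor_comp: "\<lbrakk>f \<in> hom C X X'; f' \<in> hom C X' X''; g \<in> hom C Y Y'; g' \<in> hom C Y' Y''\<rbrakk>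
      \<Longrightarrow> (f' \<cdot> f) \<boxtimes> (g' \<cdot> g) = (f' \<boxtimes> g') \<cdot> (f \<boxtimes> g)"
    and assoc_hom: "\<lbrakk>X \<in> Ob C; Y \<in> Ob C; Z \<in> Ob C\<rbrakk>
      \<Longrightarrow> \<a> X Y Z \<in> hom C ((X \<otimes> Y) \<otimes> Z) (X \<otimes> (Y \<otimes> Z))"
    and assoc_iso: "\<lbrakk>X \<in> Ob C; Y \<in> Ob C; Z \<in> Ob C\<rbrakk> \<Longrightarrow> is_iso C (\<a> X Y Z)"
    and assoc_natural: "\<lbrakk>f \<in> hom C X X'; g \<in> hom C Y Y'; h \<in> hom C Z Z'\<rbrakk>
      \<Longrightarrow> \<a> X' Y' Z' \<cdot> ((f \<boxtimes> g) \<boxtimes> h) = (f \<boxtimes> (g \<boxtimes> h)) \<cdot> \<a> X Y Z"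
    and lunit_hom: "X \<in> Ob C \<Longrightarrow> \<l> X \<in> hom C (\<I> \<otimes> X) X"
    and lunit_iso: "X \<in> Ob C \<Longrightarrow> is_iso C (\<l> X)"
    and lunit_natural: "f \<in> hom C X Y \<Longrightarrow> \<l> Y \<cdot> (\<one> \<I> \<boxtimes> f) = f \<cdot> \<l> X"
    and runit_hom: "X \<in> Ob C \<Longrightarrow> \<r> X \<in> hom C (X \<otimes> \<I>) X"
    and runit_iso: "X \<in> Ob C \<Longrightarrow> is_iso C (\<r> X)"
    and runit_natural: "f \<in> hom C X Y \<Longrightarrow> \<r> Y \<cdot> (f \<boxtimes> \<one> \<I>) = f \<cdot> \<r> X"
    and pentagon: "\<lbrakk>W \<in> Ob C; X \<in> Ob C; Y \<in> Ob C; Z \<in> Ob C\<rbrakk>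
      \<Longrightarrow> (\<one> W \<boxtimes> \<a> X Y Z) \<cdot> \<a> W (X \<otimes> Y) Z \<cdot> (\<a> W X Y \<boxtimes> \<one> Z)
        = \<a> W X (Y \<otimes> Z) \<cdot> \<a> (W \<otimes> X) Y Z"
    and triangle: "\<lbrakk>X \<in> Ob C; Y \<in> Ob C\<rbrakk>
      \<Longrightarrow> (\<one> X \<boxtimes> \<l> Y) \<cdot> \<a> X \<I> Y = \<r> X \<boxtimes> \<one> Y"

text \<open>The functor \<open>- \<otimes> X\<close>. The same data is also a functor between the opposite categories.\<close>

definition tensor_right :: "('o, 'm, 'x) moncat_scheme \<Rightarrow> 'o \<Rightarrow> ('o, 'm, 'o, 'm) func" where
  "tensor_right C X = \<lparr>OMap = (\<lambda>T. T \<otimes>\<^bsub>C\<^esub> X), AMap = (\<lambda>f. f \<boxtimes>\<^bsub>C\<^esub> \<one>\<^bsub>C\<^esub> X)\<rparr>"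

locale strong_monoidal_functor =
  source: monoidal_category C + target: monoidal_category D + cat_functor C D F
  for C :: "('o, 'm, 'x) moncat_scheme" and D :: "('p, 'n, 'y) moncat_scheme"
    and F :: "('o, 'm, 'p, 'n) func" +
  fixes \<phi> :: "'o \<Rightarrow> 'o \<Rightarrow> 'n" and \<iota> :: "'n"
  assumes mult_hom: "\<lbrakk>X \<in> Ob C; Y \<in> Ob C\<rbrakk>
      \<Longrightarrow> \<phi> X Y \<in> hom D (OMap F X \<otimes>\<^bsub>D\<^esub> OMap F Y) (OMap F (X \<otimes>\<^bsub>C\<^esub> Y))"
    and mult_iso: "\<lbrakk>X \<in> Ob C; Y \<in> Ob C\<rbrakk> \<Longrightarrow> is_iso D (\<phi> X Y)"
    and mult_natural: "\<lbrakk>f \<in> hom C X X'; g \<in> hom C Y Y'\<rbrakk>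
      \<Longrightarrow> \<phi> X' Y' \<cdot>\<^bsub>D\<^esub> (AMap F f \<boxtimes>\<^bsub>D\<^esub> AMap F g) = AMap F (f \<boxtimes>\<^bsub>C\<^esub> g) \<cdot>\<^bsub>D\<^esub> \<phi> X Y"
    and unit_hom: "\<iota> \<in> hom D \<I>\<^bsub>D\<^esub> (OMap F \<I>\<^bsub>C\<^esub>)"
    and unit_iso: "is_iso D \<iota>"
    and mult_assoc: "\<lbrakk>X \<in> Ob C; Y \<in> Ob C; Z \<in> Ob C\<rbrakk>
      \<Longrightarrow> AMap F (\<a>\<^bsub>C\<^esub> X Y Z) \<cdot>\<^bsub>D\<^esub> \<phi> (X \<otimes>\<^bsub>C\<^esub> Y) Z \<cdot>\<^bsub>D\<^esub> (\<phi> X Y \<boxtimes>\<^bsub>D\<^esub> \<one>\<^bsub>D\<^esub> (OMap F Z))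
        = \<phi> X (Y \<otimes>\<^bsub>C\<^esub> Z) \<cdot>\<^bsub>D\<^esub> (\<one>\<^bsub>D\<^esub> (OMap F X) \<boxtimes>\<^bsub>D\<^esub> \<phi> Y Z)
          \<cdot>\<^bsub>D\<^esub> \<a>\<^bsub>D\<^esub> (OMap F X) (OMap F Y) (OMap F Z)"
    and mult_lunit: "X \<in> Ob C
      \<Longrightarrow> AMap F (\<l>\<^bsub>C\<^esub> X) \<cdot>\<^bsub>D\<^esub> \<phi> \<I>\<^bsub>C\<^esub> X \<cdot>\<^bsub>D\<^esub> (\<iota> \<boxtimes>\<^bsub>D\<^esub> \<one>\<^bsub>D\<^esub> (OMap F X)) = \<l>\<^bsub>D\<^esub> (OMap F X)"
    and mult_runit: "X \<in> Ob C
      \<Longrightarrow> AMap F (\<r>\<^bsub>C\<^esub> X) \<cdot>\<^bsub>D\<^esub> \<phi> X \<I>\<^bsub>C\<^esub> \<cdot>\<^bsub>D\<^esub> (\<one>\<^bsub>D\<^esub> (OMap F X) \<boxtimes>\<^bsub>D\<^esub> \<iota>) = \<r>\<^bsub>D\<^esub> (OMap F X)"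

definition pre_dual :: "('o, 'm, 'x) moncat_scheme \<Rightarrow> 'o \<Rightarrow> 'o \<Rightarrow> 'm \<Rightarrow> bool" where
  "pre_dual C X X' ev \<longleftrightarrow> X' \<in> Ob C \<and> ev \<in> hom C (X' \<otimes>\<^bsub>C\<^esub> X) \<I>\<^bsub>C\<^esub> \<and>
    (\<forall>T \<in> Ob C. bij_betw (\<lambda>u. ev \<cdot>\<^bsub>C\<^esub> (u \<boxtimes>\<^bsub>C\<^esub> \<one>\<^bsub>C\<^esub> X)) (hom C T X') (hom C (T \<otimes>\<^bsub>C\<^esub> X) \<I>\<^bsub>C\<^esub>))"

definition pre_rigid :: "('o, 'm, 'x) moncat_scheme \<Rightarrow> bool" where
  "pre_rigid C \<longleftrightarrow> (\<forall>X \<in> Ob C. \<exists>X' ev. pre_dual C X X' ev)"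

end

theory Submission
  imports Defs
begin

text \<open>
  Let \<open>(L X)\<^sup>*\<close> be a pre-dual of \<open>L X\<close> in \<open>A\<close>. There is a chain of bijections, natural in \<open>T\<close>,
  \<open>B(T, R((L X)\<^sup>*)) \<cong> A(L T, (L X)\<^sup>*) \<cong> A(L T \<otimes> L X, I) \<cong> A(L (T \<otimes> X), L I) \<cong> B(T \<otimes> X, R L I)\<close>,
  so \<open>R((L X)\<^sup>*)\<close> represents the presheaf, and the image of its identity is the universal element.
  An isomorphism from \<open>R L I\<close> to \<open>I\<close> turns this universal element into an evaluation. If \<open>L\<close> is
  fully faithful, the preimage under \<open>L\<close> of the counit at \<open>L I\<close> is inverse to the unit at \<open>I\<close>.
\<close>

section \<open>Isomorphisms and hom-sets\<close>

lemma hom_dom: "f \<in> hom C X Y \<Longrightarrow> Dom C f = X"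
  and hom_cod: "f \<in> hom C X Y \<Longrightarrow> Cod C f = Y"
  by (auto simp: hom_def)

lemma (in category) hom_ob: "f \<in> hom C X Y \<Longrightarrow> X \<in> Ob C" "f \<in> hom C X Y \<Longrightarrow> Y \<in> Ob C"
  using dom_ob cod_ob by (auto simp: hom_def)

text \<open>\<open>is_iso\<close> is phrased with \<open>Dom C f\<close> and \<open>Cod C f\<close>;
  this rule and the next restate it for an arrow in a named hom-set, the form in which inverses are
  obtained and supplied below.\<close>

lemma is_isoE:
  assumes "is_iso C f" "f \<in> hom C X Y"
  obtains g where "g \<in> hom C Y X" "g \<cdot>\<^bsub>C\<^esub> f = \<one>\<^bsub>C\<^esub> X" "f \<cdot>\<^bsub>C\<^esub> g = \<one>\<^bsub>C\<^esub> Y"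
  using assms by (auto simp: is_iso_def hom_def)

lemma is_isoI:
  assumes "f \<in> hom C X Y" "g \<in> hom C Y X" "g \<cdot>\<^bsub>C\<^esub> f = \<one>\<^bsub>C\<^esub> X" "f \<cdot>\<^bsub>C\<^esub> g = \<one>\<^bsub>C\<^esub> Y"
  shows "is_iso C f"
  using assms by (auto simp: is_iso_def hom_def)

context category
begin

text \<open>Composing with the inverse undoes the map. This version changes the target of a
  universal pairing; the precomposition version below brings the inverse of
  \<open>\<phi> T X\<close> into the chain of bijections.\<close>

lemma bij_betw_post_iso:
  assumes "f \<in> hom C Y Z" "is_iso C f"
  shows "bij_betw (\<lambda>u. f \<cdot> u) (hom C X Y) (hom C X Z)"
proof -
  obtain g where g: "g \<in> hom C Z Y" "g \<cdot> f = \<one> Y" "f \<cdot> g = \<one> Z"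
    using assms by (metis is_isoE)
  show ?thesis
  proof (rule bij_betw_byWitness[where f' = "\<lambda>u. g \<cdot> u"])
    show "\<forall>u \<in> hom C X Y. g \<cdot> (f \<cdot> u) = u"
      using comp_assoc[OF _ assms(1) g(1)] g(2) comp_id_left by metis
    show "\<forall>u \<in> hom C X Z. f \<cdot> (g \<cdot> u) = u"
      using comp_assoc[OF _ g(1) assms(1)] g(3) comp_id_left by metis
  qed (use g assms comp_hom in blast)+
qed

lemma bij_betw_pre_iso:
  assumes "f \<in> hom C X Y" "is_iso C f"
  shows "bij_betw (\<lambda>u. u \<cdot> f) (hom C Y Z) (hom C X Z)"
proof -
  obtain g where g: "g \<in> hom C Y X" "g \<cdot> f = \<one> X" "f \<cdot> g = \<one> Y"
    using assms by (metis is_isoE)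
  show ?thesis
  proof (rule bij_betw_byWitness[where f' = "\<lambda>u. u \<cdot> g"])
    show "\<forall>u \<in> hom C Y Z. (u \<cdot> f) \<cdot> g = u"
      using comp_assoc[OF g(1) assms(1)] g(3) comp_id_right by metis
    show "\<forall>u \<in> hom C X Z. (u \<cdot> g) \<cdot> f = u"
      using comp_assoc[OF assms(1) g(1)] g(2) comp_id_right by metis
  qed (use g assms comp_hom in blast)+
qed

end


section \<open>Presheaves\<close>

lemma hom_op_cat: "hom (op_cat C) X Y = hom C Y X"
  by (auto simp: hom_def op_cat_def)

lemma op_cat_simps [simp]:
  "Ob (op_cat C) = Ob C" "\<one>\<^bsub>op_cat C\<^esub> X = \<one>\<^bsub>C\<^esub> X" "g \<cdot>\<^bsub>op_cat C\<^esub> f = f \<cdot>\<^bsub>C\<^esub> g"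
  by (simp_all add: op_cat_def)

lemma (in category) category_op_cat: "category (op_cat C)"
proof
  show "Dom (op_cat C) f \<in> Ob (op_cat C)" "Cod (op_cat C) f \<in> Ob (op_cat C)"
    if "f \<in> Ar (op_cat C)" for f
    using that dom_ob cod_ob by (auto simp: op_cat_def)
qed (auto simp: hom_op_cat id_hom comp_id_left comp_id_right comp_assoc intro: comp_hom)

section \<open>The category of sets and its isomorphisms\<close>

lemma hom_set_cat: "a \<in> hom set_cat S T \<longleftrightarrow> (\<exists>f \<in> S \<rightarrow>\<^sub>E T. a = (S, f, T))"
  by (auto simp: hom_def set_cat_def)

lemma set_cat_simps [simp]:
  "Ob set_cat = UNIV" "\<one>\<^bsub>set_cat\<^esub> S = (S, \<lambda>x\<in>S. x, S)"
  "(T', g, U) \<cdot>\<^bsub>set_cat\<^esub> (S, f, T) = (S, compose S g f, U)"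
  by (simp_all add: set_cat_def)

lemma category_set_cat: "category set_cat"
proof
  show "g \<cdot>\<^bsub>set_cat\<^esub> f \<in> hom set_cat X Z"
    if "f \<in> hom set_cat X Y" "g \<in> hom set_cat Y Z" for f g X Y Z
    using that by (fastforce simp: hom_set_cat compose_def)
  show "\<one>\<^bsub>set_cat\<^esub> Y \<cdot>\<^bsub>set_cat\<^esub> f = f" "f \<cdot>\<^bsub>set_cat\<^esub> \<one>\<^bsub>set_cat\<^esub> X = f"
    if "f \<in> hom set_cat X Y" for f X Y
    using that by (auto simp: hom_set_cat PiE_def Id_compose compose_Id)
  show "(h \<cdot>\<^bsub>set_cat\<^esub> g) \<cdot>\<^bsub>set_cat\<^esub> f = h \<cdot>\<^bsub>set_cat\<^esub> (g \<cdot>\<^bsub>set_cat\<^esub> f)"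
    if "f \<in> hom set_cat W X" "g \<in> hom set_cat X Y" "h \<in> hom set_cat Y Z" for f g h W X Y Z
    using that by (auto simp: hom_set_cat PiE_def compose_assoc)
qed (auto simp: hom_set_cat)

text \<open>The inverse arrow carries \<open>inv_into S f\<close> restricted to \<open>T\<close>,
  because arrows of \<open>set_cat\<close> must be extensional.\<close>

lemma is_iso_set_cat:
  assumes "bij_betw f S T"
  shows "is_iso set_cat (S, \<lambda>x\<in>S. f x, T)"
proof (rule is_isoI)
  have f: "f x \<in> T" "inv_into S f (f x) = x" if "x \<in> S" for x
    using assms that by (auto simp: bij_betw_def)
  have g: "inv_into S f y \<in> S" "f (inv_into S f y) = y" if "y \<in> T" for y
    using assms that by (auto simp: bij_betw_def inv_into_into f_inv_into_f)
  show "(S, \<lambda>x\<in>S. f x, T) \<in> hom set_cat S T"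
    "(T, \<lambda>y\<in>T. inv_into S f y, S) \<in> hom set_cat T S"
    using f(1) g(1) by (auto simp: hom_set_cat)
  show "(T, \<lambda>y\<in>T. inv_into S f y, S) \<cdot>\<^bsub>set_cat\<^esub> (S, \<lambda>x\<in>S. f x, T) = \<one>\<^bsub>set_cat\<^esub> S"
    "(S, \<lambda>x\<in>S. f x, T) \<cdot>\<^bsub>set_cat\<^esub> (T, \<lambda>y\<in>T. inv_into S f y, S) = \<one>\<^bsub>set_cat\<^esub> T"
    using f g by (auto simp: compose_def fun_eq_iff)
qed

section \<open>The functors that make up the presheaf: composition, Hom and tensoring\<close>

lemma cat_functor_comp_func:
  assumes "cat_functor C D F" "cat_functor D E G"
  shows "cat_functor C E (comp_func G F)"
proof -
  interpret F: cat_functor C D F by fact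
  interpret G: cat_functor D E G by fact
  show ?thesis
    by unfold_locales
      (auto simp: comp_func_def F.omap_ob G.omap_ob F.amap_id G.amap_id
        F.amap_hom G.amap_hom G.amap_comp[OF F.amap_hom F.amap_hom] F.amap_comp)
qed

lemma AMap_hom_presheaf:
  assumes "f \<in> hom C S T"
  shows "AMap (hom_presheaf C Z) f = (hom C T Z, \<lambda>h \<in> hom C T Z. h \<cdot>\<^bsub>C\<^esub> f, hom C S Z)"
  using assms by (simp add: hom_presheaf_def hom_dom hom_cod)

lemma (in category) cat_functor_hom_presheaf:
  "cat_functor (op_cat C) set_cat (hom_presheaf C Z)"
proof (intro cat_functor.intro cat_functor_axioms.intro category_op_cat category_set_cat)
  show "AMap (hom_presheaf C Z) f
      \<in> hom set_cat (OMap (hom_presheaf C Z) X) (OMap (hom_presheaf C Z) Y)"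
    if "f \<in> hom (op_cat C) X Y" for f X Y
    using that comp_hom[of f Y X]
    by (simp add: hom_op_cat AMap_hom_presheaf hom_set_cat) (simp add: hom_presheaf_def)
  show "AMap (hom_presheaf C Z) (\<one>\<^bsub>op_cat C\<^esub> X) = \<one>\<^bsub>set_cat\<^esub> (OMap (hom_presheaf C Z) X)"
    if "X \<in> Ob (op_cat C)" for X
    using that AMap_hom_presheaf[OF id_hom, of X Z]
    by (auto simp: comp_id_right fun_eq_iff) (simp_all add: hom_presheaf_def)
  show "AMap (hom_presheaf C Z) (g \<cdot>\<^bsub>op_cat C\<^esub> f)
      = AMap (hom_presheaf C Z) g \<cdot>\<^bsub>set_cat\<^esub> AMap (hom_presheaf C Z) f"
    if "f \<in> hom (op_cat C) X Y" "g \<in> hom (op_cat C) Y Y'" for f g X Y Y'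
  proof -
    have f: "f \<in> hom C Y X" and g: "g \<in> hom C Y' Y"
      using that by (simp_all add: hom_op_cat)
    \<comment> \<open>On \<open>hom C X Z\<close> this is associativity; elsewhere both functions
      are \<open>undefined\<close>.\<close>
    show ?thesis
      unfolding op_cat_simps AMap_hom_presheaf[OF f] AMap_hom_presheaf[OF g]
        AMap_hom_presheaf[OF comp_hom[OF g f]]
      by (auto simp: compose_def fun_eq_iff comp_assoc[OF g f] comp_hom[OF f])
  qed
qed auto

text \<open>The interchange law with \<open>\<one> X\<close> as both arrows of the second factor,
  since \<open>\<one> X\<close> composed with itself is \<open>\<one> X\<close>.\<close>

lemma (in monoidal_category) tensor_comp_right:
  assumes "f \<in> hom C S T" "g \<in> hom C T U" "X \<in> Ob C"
  shows "(g \<cdot> f) \<boxtimes> \<one> X = (g \<boxtimes> \<one> X) \<cdot> (f \<boxtimes> \<one> X)"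
  using tensor_comp[OF assms(1,2) id_hom[OF assms(3)] id_hom[OF assms(3)]]
  by (simp add: comp_id_left[OF id_hom[OF assms(3)]])

text \<open>Both ends are opposite categories, so that a presheaf on \<open>C\<close> can be
  composed after it.\<close>

lemma (in monoidal_category) cat_functor_tensor_right:
  assumes "X \<in> Ob C"
  shows "cat_functor (op_cat C) (op_cat C) (tensor_right C X)"
proof (intro cat_functor.intro cat_functor_axioms.intro category_op_cat)
  show "AMap (tensor_right C X) f
      \<in> hom (op_cat C) (OMap (tensor_right C X) S) (OMap (tensor_right C X) T)"
    if "f \<in> hom (op_cat C) S T" for f S T
    using that tensor_hom[OF _ id_hom[OF assms]] by (simp add: tensor_right_def hom_op_cat)
  show "AMap (tensor_right C X) (g \<cdot>\<^bsub>op_cat C\<^esub> f)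
      = AMap (tensor_right C X) g \<cdot>\<^bsub>op_cat C\<^esub> AMap (tensor_right C X) f"
    if "f \<in> hom (op_cat C) S T" "g \<in> hom (op_cat C) T U" for f g S T U
    using that tensor_comp_right[OF _ _ assms] by (simp add: tensor_right_def hom_op_cat)
qed (use assms in \<open>simp_all add: tensor_right_def tensor_ob tensor_id\<close>)


section \<open>Universal pairings\<close>

text \<open>The universal elements of \<open>Hom(- \<otimes> X, Z)\<close>; the pre-duals are the case \<open>Z = I\<close>.\<close>

definition universal_pairing ::
    "('o, 'm, 'x) moncat_scheme \<Rightarrow> 'o \<Rightarrow> 'o \<Rightarrow> 'o \<Rightarrow> 'm \<Rightarrow> bool" where
  "universal_pairing C X Z P e \<longleftrightarrow> P \<in> Ob C \<and> e \<in> hom C (P \<otimes>\<^bsub>C\<^esub> X) Z \<and>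
    (\<forall>T \<in> Ob C. bij_betw (\<lambda>u. e \<cdot>\<^bsub>C\<^esub> (u \<boxtimes>\<^bsub>C\<^esub> \<one>\<^bsub>C\<^esub> X)) (hom C T P) (hom C (T \<otimes>\<^bsub>C\<^esub> X) Z))"

lemma pre_dual_eq_universal_pairing: "pre_dual C X = universal_pairing C X \<I>\<^bsub>C\<^esub>"
  by (simp add: pre_dual_def universal_pairing_def fun_eq_iff)

context monoidal_category
begin

text \<open>Yoneda: the universal element \<open>e\<close> induces the transformation
  \<open>u \<mapsto> e \<cdot> (u \<boxtimes> \<one> X)\<close>, natural by functoriality of
  \<open>- \<otimes> X\<close> and bijective in each component by hypothesis.\<close>

lemma representable_of_universal_pairing:
  assumes X: "X \<in> Ob C" and "universal_pairing C X Z P e"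
  shows "representable C (comp_func (hom_presheaf C Z) (tensor_right C X))"
proof -
  let ?G = "comp_func (hom_presheaf C Z) (tensor_right C X)"
  define p where "p u = e \<cdot> (u \<boxtimes> \<one> X)" for u
  define \<tau> where "\<tau> T = (hom C T P, \<lambda>u \<in> hom C T P. p u, hom C (T \<otimes> X) Z)" for T
  have P: "P \<in> Ob C" and e: "e \<in> hom C (P \<otimes> X) Z"
    and bij: "\<And>T. T \<in> Ob C \<Longrightarrow> bij_betw p (hom C T P) (hom C (T \<otimes> X) Z)"
    using assms(2) by (auto simp: universal_pairing_def p_def[abs_def])
  have p_hom: "p u \<in> hom C (T \<otimes> X) Z" if "u \<in> hom C T P" for u T
    using that bij hom_ob(1) by (blast dest: bij_betwE)
  \<comment> \<open>Naturality at the level of elements, from which the square for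
    \<open>\<tau>\<close> follows.\<close>
  have p_comp: "p (u \<cdot> f) = p u \<cdot> (f \<boxtimes> \<one> X)" if "f \<in> hom C S T" "u \<in> hom C T P" for f u S T
    unfolding p_def tensor_comp_right[OF that X]
    using comp_assoc[OF tensor_hom[OF that(1) id_hom[OF X]] tensor_hom[OF that(2) id_hom[OF X]] e]
    by simp
  have "nat_isomorphism (op_cat C) set_cat (hom_presheaf C P) ?G \<tau>"
  proof (intro nat_isomorphism.intro nat_isomorphism_axioms.intro nat_transformation.intro
      nat_transformation_axioms.intro cat_functor_hom_presheaf
      cat_functor_comp_func[OF cat_functor_tensor_right[OF X] cat_functor_hom_presheaf])
    show "\<tau> T \<in> hom set_cat (OMap (hom_presheaf C P) T) (OMap ?G T)" for T
      by (auto simp: \<tau>_def hom_set_cat hom_presheaf_def comp_func_def tensor_right_def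
          intro: p_hom)
    show "is_iso set_cat (\<tau> T)" if "T \<in> Ob (op_cat C)" for T
      using that unfolding \<tau>_def by (intro is_iso_set_cat bij) simp
    show "\<tau> S \<cdot>\<^bsub>set_cat\<^esub> AMap (hom_presheaf C P) f = AMap ?G f \<cdot>\<^bsub>set_cat\<^esub> \<tau> T"
      if "f \<in> hom (op_cat C) T S" for f T S
    proof -
      \<comment> \<open>In \<open>C\<close> the arrow \<open>f\<close> runs from \<open>S\<close> to
        \<open>T\<close>, so the square leads from \<open>hom C T P\<close> to
        \<open>hom C (S \<otimes> X) Z\<close>.\<close>
      have f: "f \<in> hom C S T" using that by (simp add: hom_op_cat)
      have G: "AMap ?G f = (hom C (T \<otimes> X) Z, \<lambda>h \<in> hom C (T \<otimes> X) Z. h \<cdot> (f \<boxtimes> \<one> X),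
          hom C (S \<otimes> X) Z)"
        using AMap_hom_presheaf[OF tensor_hom[OF f id_hom[OF X]]]
        by (simp add: comp_func_def tensor_right_def)
      show ?thesis
        unfolding G AMap_hom_presheaf[OF f] \<tau>_def
        by (auto simp: compose_def fun_eq_iff p_comp[OF f] p_hom comp_hom[OF f])
    qed
  qed
  then show ?thesis
    using P unfolding representable_def by blast
qed

text \<open>Postcomposition with \<open>f\<close> is a bijection on hom-sets and is compatible with
  the pairing by associativity. It serves twice: to pass from the unit of \<open>A\<close> to
  \<open>L \<I>\<close>, and from \<open>R L \<I>\<close> to \<open>\<I>\<close> in
  \<open>B\<close>.\<close>

lemma universal_pairing_iso:
  assumes "X \<in> Ob C" "universal_pairing C X Z P e" "f \<in> hom C Z Z'" "is_iso C f"
  shows "universal_pairing C X Z' P (f \<cdot> e)"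
  unfolding universal_pairing_def
proof (intro conjI ballI)
  have e: "e \<in> hom C (P \<otimes> X) Z"
    using assms(2) by (simp add: universal_pairing_def)
  show "P \<in> Ob C"
    using assms(2) by (simp add: universal_pairing_def)
  show "f \<cdot> e \<in> hom C (P \<otimes> X) Z'"
    using e assms(3) by (rule comp_hom)
  fix T assume T: "T \<in> Ob C"
  have "bij_betw ((\<lambda>u. f \<cdot> u) \<circ> (\<lambda>u. e \<cdot> (u \<boxtimes> \<one> X))) (hom C T P) (hom C (T \<otimes> X) Z')"
    using assms(2) T
    by (intro bij_betw_trans[OF _ bij_betw_post_iso[OF assms(3,4)]])
      (simp add: universal_pairing_def)
  then show "bij_betw (\<lambda>u. (f \<cdot> e) \<cdot> (u \<boxtimes> \<one> X)) (hom C T P) (hom C (T \<otimes> X) Z')"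
    by (rule bij_betw_cong[THEN iffD1, rotated])
      (simp add: comp_assoc[OF tensor_hom[OF _ id_hom[OF assms(1)]] e assms(3)])
qed

end


section \<open>Adjunctions\<close>

context adjunction
begin

text \<open>This and the next three facts free the components and squares of \<open>\<eta>\<close>
  and \<open>\<epsilon>\<close> from \<open>id_func\<close> and \<open>comp_func\<close>.\<close>

lemma unit_hom: "X \<in> Ob B \<Longrightarrow> \<eta> X \<in> hom B X (OMap R (OMap L X))"
  using unit.component_hom by (simp add: id_func_def comp_func_def)

lemma counit_hom: "Y \<in> Ob A \<Longrightarrow> \<epsilon> Y \<in> hom A (OMap L (OMap R Y)) Y"
  using counit.component_hom by (simp add: id_func_def comp_func_def)

lemma unit_natural:
  "f \<in> hom B X Y \<Longrightarrow> \<eta> Y \<cdot>\<^bsub>B\<^esub> f = AMap R (AMap L f) \<cdot>\<^bsub>B\<^esub> \<eta> X"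
  using unit.naturality by (simp add: id_func_def comp_func_def)

lemma counit_natural:
  "f \<in> hom A X Y \<Longrightarrow> \<epsilon> Y \<cdot>\<^bsub>A\<^esub> AMap L (AMap R f) = f \<cdot>\<^bsub>A\<^esub> \<epsilon> X"
  using counit.naturality by (simp add: id_func_def comp_func_def)

lemma transpose_hom:
  assumes "X \<in> Ob B" "g \<in> hom A (OMap L X) Y"
  shows "AMap R g \<cdot>\<^bsub>B\<^esub> \<eta> X \<in> hom B X (OMap R Y)"
  using unit_hom[OF assms(1)] right.amap_hom[OF assms(2)] by (rule left.source.comp_hom)

lemma cotranspose_hom:
  assumes "Y \<in> Ob A" "f \<in> hom B X (OMap R Y)"
  shows "\<epsilon> Y \<cdot>\<^bsub>A\<^esub> AMap L f \<in> hom A (OMap L X) Y"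
  using left.amap_hom[OF assms(2)] counit_hom[OF assms(1)] by (rule left.target.comp_hom)

text \<open>Naturality of \<open>\<epsilon>\<close> carries \<open>g\<close> past the counit; the
  left triangle identity cancels what remains.\<close>

lemma cotranspose_transpose:
  assumes X: "X \<in> Ob B" and g: "g \<in> hom A (OMap L X) Y"
  shows "\<epsilon> Y \<cdot>\<^bsub>A\<^esub> AMap L (AMap R g \<cdot>\<^bsub>B\<^esub> \<eta> X) = g"
proof -
  have Y: "Y \<in> Ob A" and LX: "OMap L X \<in> Ob A"
    using g left.target.hom_ob by blast+
  have L\<eta>: "AMap L (\<eta> X) \<in> hom A (OMap L X) (OMap L (OMap R (OMap L X)))"
    and LRg: "AMap L (AMap R g) \<in> hom A (OMap L (OMap R (OMap L X))) (OMap L (OMap R Y))"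
    by (intro left.amap_hom right.amap_hom unit_hom X g)+
  have "\<epsilon> Y \<cdot>\<^bsub>A\<^esub> AMap L (AMap R g \<cdot>\<^bsub>B\<^esub> \<eta> X)
      = \<epsilon> Y \<cdot>\<^bsub>A\<^esub> (AMap L (AMap R g) \<cdot>\<^bsub>A\<^esub> AMap L (\<eta> X))"
    using left.amap_comp[OF unit_hom[OF X] right.amap_hom[OF g]] by simp
  also have "\<dots> = (\<epsilon> Y \<cdot>\<^bsub>A\<^esub> AMap L (AMap R g)) \<cdot>\<^bsub>A\<^esub> AMap L (\<eta> X)"
    by (rule left.target.comp_assoc[OF L\<eta> LRg counit_hom[OF Y], symmetric])
  also have "\<dots> = g \<cdot>\<^bsub>A\<^esub> (\<epsilon> (OMap L X) \<cdot>\<^bsub>A\<^esub> AMap L (\<eta> X))"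
    unfolding counit_natural[OF g] by (rule left.target.comp_assoc[OF L\<eta> counit_hom[OF LX] g])
  also have "\<dots> = g"
    using triangle_left[OF X] left.target.comp_id_right[OF g] by simp
  finally show ?thesis .
qed

text \<open>The dual argument, by naturality of \<open>\<eta>\<close> and the right triangle
  identity.\<close>

lemma transpose_cotranspose:
  assumes Y: "Y \<in> Ob A" and f: "f \<in> hom B X (OMap R Y)"
  shows "AMap R (\<epsilon> Y \<cdot>\<^bsub>A\<^esub> AMap L f) \<cdot>\<^bsub>B\<^esub> \<eta> X = f"
proof -
  have X: "X \<in> Ob B" and RY: "OMap R Y \<in> Ob B"
    using f left.source.hom_ob by blast+
  have R\<epsilon>: "AMap R (\<epsilon> Y) \<in> hom B (OMap R (OMap L (OMap R Y))) (OMap R Y)"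
    and RLf: "AMap R (AMap L f) \<in> hom B (OMap R (OMap L X)) (OMap R (OMap L (OMap R Y)))"
    by (intro left.amap_hom right.amap_hom counit_hom Y f)+
  have "AMap R (\<epsilon> Y \<cdot>\<^bsub>A\<^esub> AMap L f) \<cdot>\<^bsub>B\<^esub> \<eta> X
      = (AMap R (\<epsilon> Y) \<cdot>\<^bsub>B\<^esub> AMap R (AMap L f)) \<cdot>\<^bsub>B\<^esub> \<eta> X"
    using right.amap_comp[OF left.amap_hom[OF f] counit_hom[OF Y]] by simp
  also have "\<dots> = AMap R (\<epsilon> Y) \<cdot>\<^bsub>B\<^esub> (\<eta> (OMap R Y) \<cdot>\<^bsub>B\<^esub> f)"
    unfolding unit_natural[OF f] by (rule left.source.comp_assoc[OF unit_hom[OF X] RLf R\<epsilon>])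
  also have "\<dots> = (AMap R (\<epsilon> Y) \<cdot>\<^bsub>B\<^esub> \<eta> (OMap R Y)) \<cdot>\<^bsub>B\<^esub> f"
    by (rule left.source.comp_assoc[OF f unit_hom[OF RY] R\<epsilon>, symmetric])
  also have "\<dots> = f"
    using triangle_right[OF Y] left.source.comp_id_left[OF f] by simp
  finally show ?thesis .
qed

text \<open>Both directions of the adjunction bijection are recorded: the chain enters
  \<open>A\<close> by the cotranspose and returns to \<open>B\<close> by the transpose.\<close>

lemma bij_betw_transpose:
  assumes "X \<in> Ob B" "Y \<in> Ob A"
  shows "bij_betw (\<lambda>g. AMap R g \<cdot>\<^bsub>B\<^esub> \<eta> X) (hom A (OMap L X) Y) (hom B X (OMap R Y))"
  by (rule bij_betw_byWitness[where f' = "\<lambda>f. \<epsilon> Y \<cdot>\<^bsub>A\<^esub> AMap L f"])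
    (use assms in \<open>auto simp: cotranspose_transpose transpose_cotranspose
      intro: transpose_hom cotranspose_hom\<close>)

lemma bij_betw_cotranspose:
  assumes "X \<in> Ob B" "Y \<in> Ob A"
  shows "bij_betw (\<lambda>f. \<epsilon> Y \<cdot>\<^bsub>A\<^esub> AMap L f) (hom B X (OMap R Y)) (hom A (OMap L X) Y)"
  by (rule bij_betw_byWitness[where f' = "\<lambda>g. AMap R g \<cdot>\<^bsub>B\<^esub> \<eta> X"])
    (use assms in \<open>auto simp: cotranspose_transpose transpose_cotranspose
      intro: transpose_hom cotranspose_hom\<close>)

lemma unit_iso_of_fully_faithful:
  assumes "fully_faithful B A L" and X: "X \<in> Ob B"
  shows "is_iso B (\<eta> X)"
proof -
  let ?RLX = "OMap R (OMap L X)"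
  have LX: "OMap L X \<in> Ob A" and RLX: "?RLX \<in> Ob B"
    using X left.omap_ob right.omap_ob by auto
  \<comment> \<open>Fullness of \<open>L\<close> lifts the counit at \<open>L X\<close> to an arrow
    of \<open>B\<close>.\<close>
  have "\<epsilon> (OMap L X) \<in> AMap L ` hom B ?RLX X"
    using assms RLX counit_hom[OF LX] by (auto simp: fully_faithful_def bij_betw_def)
  then obtain g where g: "g \<in> hom B ?RLX X" "AMap L g = \<epsilon> (OMap L X)" by auto
  show ?thesis
  proof (rule is_isoI[OF unit_hom[OF X] g(1)])
    \<comment> \<open>Faithfulness reduces this composite to its image under \<open>L\<close>, which
      is the left triangle identity.\<close>
    have "AMap L (g \<cdot>\<^bsub>B\<^esub> \<eta> X) = AMap L (\<one>\<^bsub>B\<^esub> X)"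
      using left.amap_comp[OF unit_hom[OF X] g(1)] g(2) triangle_left[OF X] left.amap_id[OF X]
      by simp
    moreover have "inj_on (AMap L) (hom B X X)"
      using assms by (auto simp: fully_faithful_def bij_betw_def)
    ultimately show "g \<cdot>\<^bsub>B\<^esub> \<eta> X = \<one>\<^bsub>B\<^esub> X"
      using left.source.comp_hom[OF unit_hom[OF X] g(1)] left.source.id_hom[OF X]
      by (auto dest: inj_onD)
    \<comment> \<open>Naturality of \<open>\<eta>\<close> at \<open>g\<close> turns this composite
      into the right triangle identity at \<open>L X\<close>.\<close>
    show "\<eta> X \<cdot>\<^bsub>B\<^esub> g = \<one>\<^bsub>B\<^esub> ?RLX"
      using unit_natural[OF g(1)] g(2) triangle_right[OF LX] by simp
  qed
qed

end


section \<open>Transport of universal pairings along a strong monoidal left adjoint\<close>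

text \<open>Inverses of a natural isomorphism are natural: insert \<open>\<phi> T X\<close> followed
  by its inverse, apply naturality of \<open>\<phi>\<close>, and cancel \<open>h\<close> against
  \<open>\<phi> S X\<close>. The insertion uses a right inverse at \<open>T\<close>, the
  cancellation a left inverse at \<open>S\<close>.\<close>

lemma (in strong_monoidal_functor) mult_inverse_natural:
  assumes f: "f \<in> hom C T S" and X: "X \<in> Ob C"
    and g: "g \<in> hom D (OMap F (T \<otimes>\<^bsub>C\<^esub> X)) (OMap F T \<otimes>\<^bsub>D\<^esub> OMap F X)"
      "\<phi> T X \<cdot>\<^bsub>D\<^esub> g = \<one>\<^bsub>D\<^esub> (OMap F (T \<otimes>\<^bsub>C\<^esub> X))"
    and h: "h \<in> hom D (OMap F (S \<otimes>\<^bsub>C\<^esub> X)) (OMap F S \<otimes>\<^bsub>D\<^esub> OMap F X)"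
      "h \<cdot>\<^bsub>D\<^esub> \<phi> S X = \<one>\<^bsub>D\<^esub> (OMap F S \<otimes>\<^bsub>D\<^esub> OMap F X)"
  shows "h \<cdot>\<^bsub>D\<^esub> AMap F (f \<boxtimes>\<^bsub>C\<^esub> \<one>\<^bsub>C\<^esub> X) = (AMap F f \<boxtimes>\<^bsub>D\<^esub> \<one>\<^bsub>D\<^esub> (OMap F X)) \<cdot>\<^bsub>D\<^esub> g"
proof -
  have T: "T \<in> Ob C" and S: "S \<in> Ob C"
    using f source.hom_ob by blast+
  let ?Ff = "AMap F f \<boxtimes>\<^bsub>D\<^esub> \<one>\<^bsub>D\<^esub> (OMap F X)" and ?Ft = "AMap F (f \<boxtimes>\<^bsub>C\<^esub> \<one>\<^bsub>C\<^esub> X)"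
  have Ff: "?Ff \<in> hom D (OMap F T \<otimes>\<^bsub>D\<^esub> OMap F X) (OMap F S \<otimes>\<^bsub>D\<^esub> OMap F X)"
    by (intro target.tensor_hom amap_hom f target.id_hom omap_ob X)
  have Ft: "?Ft \<in> hom D (OMap F (T \<otimes>\<^bsub>C\<^esub> X)) (OMap F (S \<otimes>\<^bsub>C\<^esub> X))"
    by (intro source.tensor_hom amap_hom f source.id_hom X)
  note \<phi>T = mult_hom[OF T X] and \<phi>S = mult_hom[OF S X]
  have nat: "\<phi> S X \<cdot>\<^bsub>D\<^esub> ?Ff = ?Ft \<cdot>\<^bsub>D\<^esub> \<phi> T X"
    using mult_natural[OF f source.id_hom[OF X]] by (simp add: amap_id[OF X])
  have "h \<cdot>\<^bsub>D\<^esub> ?Ft = h \<cdot>\<^bsub>D\<^esub> (?Ft \<cdot>\<^bsub>D\<^esub> (\<phi> T X \<cdot>\<^bsub>D\<^esub> g))"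
    using g(2) target.comp_id_right[OF Ft] by simp
  also have "\<dots> = h \<cdot>\<^bsub>D\<^esub> ((\<phi> S X \<cdot>\<^bsub>D\<^esub> ?Ff) \<cdot>\<^bsub>D\<^esub> g)"
    using target.comp_assoc[OF g(1) \<phi>T Ft] nat by simp
  also have "\<dots> = h \<cdot>\<^bsub>D\<^esub> (\<phi> S X \<cdot>\<^bsub>D\<^esub> (?Ff \<cdot>\<^bsub>D\<^esub> g))"
    using target.comp_assoc[OF g(1) Ff \<phi>S] by simp
  also have "\<dots> = (h \<cdot>\<^bsub>D\<^esub> \<phi> S X) \<cdot>\<^bsub>D\<^esub> (?Ff \<cdot>\<^bsub>D\<^esub> g)"
    by (rule target.comp_assoc[OF target.comp_hom[OF g(1) Ff] \<phi>S h(1), symmetric])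
  also have "\<dots> = ?Ff \<cdot>\<^bsub>D\<^esub> g"
    using h(2) target.comp_id_left[OF target.comp_hom[OF g(1) Ff]] by simp
  finally show ?thesis .
qed

text \<open>The chain of bijections for a general target \<open>Z\<close>. As in the Yoneda lemma,
  naturality in \<open>T\<close> identifies the composite bijection with pairing against the image
  of the identity of \<open>R P\<close>.\<close>

lemma universal_pairing_right_adjoint:
  assumes "adjunction B A L R \<eta> \<epsilon>" "strong_monoidal_functor B A L \<phi> \<iota>"
    and X: "X \<in> Ob B" and ev: "universal_pairing A (OMap L X) Z P ev"
  shows "\<exists>e. universal_pairing B X (OMap R Z) (OMap R P) e"
proof -
  interpret adjunction B A L R \<eta> \<epsilon> by fact
  interpret L: strong_monoidal_functor B A L \<phi> \<iota> by fact
  let ?LX = "OMap L X" and ?RP = "OMap R P"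
  have LX: "?LX \<in> Ob A" using X by (rule left.omap_ob)
  have P: "P \<in> Ob A" and ev_hom: "ev \<in> hom A (P \<otimes>\<^bsub>A\<^esub> ?LX) Z"
    and ev_bij: "\<And>T. T \<in> Ob A \<Longrightarrow> bij_betw (\<lambda>u. ev \<cdot>\<^bsub>A\<^esub> (u \<boxtimes>\<^bsub>A\<^esub> \<one>\<^bsub>A\<^esub> ?LX)) (hom A T P)
      (hom A (T \<otimes>\<^bsub>A\<^esub> ?LX) Z)"
    using ev by (auto simp: universal_pairing_def)
  have Z: "Z \<in> Ob A" and RP: "?RP \<in> Ob B"
    using ev_hom left.target.hom_ob P right.omap_ob by blast+
  \<comment> \<open>Inverses of \<open>\<phi> T X\<close> are chosen for all \<open>T\<close> at
    once, giving a family \<open>\<psi>\<close>.\<close>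
  have "\<exists>g. g \<in> hom A (OMap L (T \<otimes>\<^bsub>B\<^esub> X)) (OMap L T \<otimes>\<^bsub>A\<^esub> ?LX)
      \<and> g \<cdot>\<^bsub>A\<^esub> \<phi> T X = \<one>\<^bsub>A\<^esub> (OMap L T \<otimes>\<^bsub>A\<^esub> ?LX)
      \<and> \<phi> T X \<cdot>\<^bsub>A\<^esub> g = \<one>\<^bsub>A\<^esub> (OMap L (T \<otimes>\<^bsub>B\<^esub> X))" if "T \<in> Ob B" for T
    using is_isoE[OF L.mult_iso[OF that X] L.mult_hom[OF that X]] by metis
  then obtain \<psi> where \<psi>:
      "\<And>T. T \<in> Ob B \<Longrightarrow> \<psi> T \<in> hom A (OMap L (T \<otimes>\<^bsub>B\<^esub> X)) (OMap L T \<otimes>\<^bsub>A\<^esub> ?LX)"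
      "\<And>T. T \<in> Ob B \<Longrightarrow> \<psi> T \<cdot>\<^bsub>A\<^esub> \<phi> T X = \<one>\<^bsub>A\<^esub> (OMap L T \<otimes>\<^bsub>A\<^esub> ?LX)"
      "\<And>T. T \<in> Ob B \<Longrightarrow> \<phi> T X \<cdot>\<^bsub>A\<^esub> \<psi> T = \<one>\<^bsub>A\<^esub> (OMap L (T \<otimes>\<^bsub>B\<^esub> X))"
    by metis
  \<comment> \<open>\<open>k\<close> follows the chain inside \<open>A\<close>: cotranspose
    \<open>u\<close>, pair with \<open>ev\<close>, precompose with \<open>\<psi> T\<close>. Then
    \<open>\<kappa>\<close> transposes the result back to \<open>B\<close>.\<close>
  define k where "k T u = (ev \<cdot>\<^bsub>A\<^esub> ((\<epsilon> P \<cdot>\<^bsub>A\<^esub> AMap L u) \<boxtimes>\<^bsub>A\<^esub> \<one>\<^bsub>A\<^esub> ?LX)) \<cdot>\<^bsub>A\<^esub> \<psi> T" for T u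
  define \<kappa> where "\<kappa> T u = AMap R (k T u) \<cdot>\<^bsub>B\<^esub> \<eta> (T \<otimes>\<^bsub>B\<^esub> X)" for T u
  have k_bij: "bij_betw (k T) (hom B T ?RP) (hom A (OMap L (T \<otimes>\<^bsub>B\<^esub> X)) Z)"
    if T: "T \<in> Ob B" for T
  proof -
    have "is_iso A (\<psi> T)"
      by (rule is_isoI[OF \<psi>(1) L.mult_hom]) (use \<psi> T X in auto)
    then show ?thesis
      using bij_betw_trans[OF bij_betw_trans[OF bij_betw_cotranspose[OF T P]
            ev_bij[OF left.omap_ob[OF T]]] left.target.bij_betw_pre_iso[OF \<psi>(1)[OF T]]]
      by (simp add: k_def[abs_def] comp_def)
  qed
  have \<kappa>_bij: "bij_betw (\<kappa> T) (hom B T ?RP) (hom B (T \<otimes>\<^bsub>B\<^esub> X) (OMap R Z))"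
    if T: "T \<in> Ob B" for T
    using bij_betw_trans[OF k_bij[OF T] bij_betw_transpose[OF L.source.tensor_ob[OF T X] Z]]
    by (simp add: \<kappa>_def[abs_def] comp_def)
  \<comment> \<open>The universal element is the image of the identity under the whole
    chain.\<close>
  define e where "e = \<kappa> ?RP (\<one>\<^bsub>B\<^esub> ?RP)"
  have id_RP: "\<one>\<^bsub>B\<^esub> ?RP \<in> hom B ?RP ?RP"
    using RP by (rule left.source.id_hom)
  \<comment> \<open>Naturality of \<open>k\<close>, evaluated at the identity of
    \<open>R P\<close>.\<close>
  have k_eq: "k ?RP (\<one>\<^bsub>B\<^esub> ?RP) \<cdot>\<^bsub>A\<^esub> AMap L (u \<boxtimes>\<^bsub>B\<^esub> \<one>\<^bsub>B\<^esub> X) = k T u"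
    if u: "u \<in> hom B T ?RP" for T u
  proof -
    have T: "T \<in> Ob B" using u left.source.hom_ob by blast
    \<comment> \<open>These collapse the cotranspose of the identity to
      \<open>\<epsilon> P\<close>.\<close>
    note [simp] = left.amap_id[OF RP] left.target.comp_id_right[OF counit_hom[OF P]]
    have Lu: "AMap L u \<boxtimes>\<^bsub>A\<^esub> \<one>\<^bsub>A\<^esub> ?LX
        \<in> hom A (OMap L T \<otimes>\<^bsub>A\<^esub> ?LX) (OMap L ?RP \<otimes>\<^bsub>A\<^esub> ?LX)"
      by (intro L.target.tensor_hom left.amap_hom u left.target.id_hom LX)
    have \<epsilon>1: "\<epsilon> P \<boxtimes>\<^bsub>A\<^esub> \<one>\<^bsub>A\<^esub> ?LX \<in> hom A (OMap L ?RP \<otimes>\<^bsub>A\<^esub> ?LX) (P \<otimes>\<^bsub>A\<^esub> ?LX)"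
      by (intro L.target.tensor_hom counit_hom P left.target.id_hom LX)
    have Lt: "AMap L (u \<boxtimes>\<^bsub>B\<^esub> \<one>\<^bsub>B\<^esub> X) \<in> hom A (OMap L (T \<otimes>\<^bsub>B\<^esub> X)) (OMap L (?RP \<otimes>\<^bsub>B\<^esub> X))"
      by (intro left.amap_hom L.source.tensor_hom u left.source.id_hom X)
    let ?a = "ev \<cdot>\<^bsub>A\<^esub> (\<epsilon> P \<boxtimes>\<^bsub>A\<^esub> \<one>\<^bsub>A\<^esub> ?LX)"
    have a: "?a \<in> hom A (OMap L ?RP \<otimes>\<^bsub>A\<^esub> ?LX) Z"
      using \<epsilon>1 ev_hom by (rule left.target.comp_hom)
    have "k ?RP (\<one>\<^bsub>B\<^esub> ?RP) \<cdot>\<^bsub>A\<^esub> AMap L (u \<boxtimes>\<^bsub>B\<^esub> \<one>\<^bsub>B\<^esub> X)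
        = ?a \<cdot>\<^bsub>A\<^esub> (\<psi> ?RP \<cdot>\<^bsub>A\<^esub> AMap L (u \<boxtimes>\<^bsub>B\<^esub> \<one>\<^bsub>B\<^esub> X))"
      using left.target.comp_assoc[OF Lt \<psi>(1)[OF RP] a] by (simp add: k_def)
    also have "\<dots> = ?a \<cdot>\<^bsub>A\<^esub> ((AMap L u \<boxtimes>\<^bsub>A\<^esub> \<one>\<^bsub>A\<^esub> ?LX) \<cdot>\<^bsub>A\<^esub> \<psi> T)"
      using L.mult_inverse_natural[OF u X \<psi>(1)[OF T] \<psi>(3)[OF T] \<psi>(1)[OF RP] \<psi>(2)[OF RP]]
      by simp
    also have "\<dots> = (?a \<cdot>\<^bsub>A\<^esub> (AMap L u \<boxtimes>\<^bsub>A\<^esub> \<one>\<^bsub>A\<^esub> ?LX)) \<cdot>\<^bsub>A\<^esub> \<psi> T"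
      by (rule left.target.comp_assoc[OF \<psi>(1)[OF T] Lu a, symmetric])
    \<comment> \<open>Interchange merges the two tensored arrows into the cotranspose of
      \<open>u\<close> tensored with the identity.\<close>
    also have "\<dots> = k T u"
      using left.target.comp_assoc[OF Lu \<epsilon>1 ev_hom]
        L.target.tensor_comp_right[OF left.amap_hom[OF u] counit_hom[OF P] LX]
      by (simp add: k_def)
    finally show ?thesis .
  qed
  \<comment> \<open>Naturality of \<open>\<eta>\<close> carries \<open>k_eq\<close> through the
    transpose.\<close>
  have \<kappa>_eq: "e \<cdot>\<^bsub>B\<^esub> (u \<boxtimes>\<^bsub>B\<^esub> \<one>\<^bsub>B\<^esub> X) = \<kappa> T u" if u: "u \<in> hom B T ?RP" for T u
  proof -
    have TX: "T \<otimes>\<^bsub>B\<^esub> X \<in> Ob B" and RPX: "?RP \<otimes>\<^bsub>B\<^esub> X \<in> Ob B"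
      using u left.source.hom_ob RP X by (blast intro: L.source.tensor_ob)+
    have t: "u \<boxtimes>\<^bsub>B\<^esub> \<one>\<^bsub>B\<^esub> X \<in> hom B (T \<otimes>\<^bsub>B\<^esub> X) (?RP \<otimes>\<^bsub>B\<^esub> X)"
      by (intro L.source.tensor_hom u left.source.id_hom X)
    let ?k = "k ?RP (\<one>\<^bsub>B\<^esub> ?RP)"
    have k: "?k \<in> hom A (OMap L (?RP \<otimes>\<^bsub>B\<^esub> X)) Z"
      using k_bij[OF RP] id_RP by (rule bij_betwE[THEN bspec])
    have "e \<cdot>\<^bsub>B\<^esub> (u \<boxtimes>\<^bsub>B\<^esub> \<one>\<^bsub>B\<^esub> X)
        = AMap R ?k \<cdot>\<^bsub>B\<^esub> (\<eta> (?RP \<otimes>\<^bsub>B\<^esub> X) \<cdot>\<^bsub>B\<^esub> (u \<boxtimes>\<^bsub>B\<^esub> \<one>\<^bsub>B\<^esub> X))"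
      unfolding e_def \<kappa>_def
      by (rule left.source.comp_assoc[OF t unit_hom[OF RPX] right.amap_hom[OF k]])
    also have "\<dots> = AMap R ?k \<cdot>\<^bsub>B\<^esub>
        (AMap R (AMap L (u \<boxtimes>\<^bsub>B\<^esub> \<one>\<^bsub>B\<^esub> X)) \<cdot>\<^bsub>B\<^esub> \<eta> (T \<otimes>\<^bsub>B\<^esub> X))"
      using unit_natural[OF t] by simp
    also have "\<dots> = (AMap R ?k \<cdot>\<^bsub>B\<^esub> AMap R (AMap L (u \<boxtimes>\<^bsub>B\<^esub> \<one>\<^bsub>B\<^esub> X)))
        \<cdot>\<^bsub>B\<^esub> \<eta> (T \<otimes>\<^bsub>B\<^esub> X)"
      by (rule left.source.comp_assoc[OF unit_hom[OF TX]
            right.amap_hom[OF left.amap_hom[OF t]] right.amap_hom[OF k], symmetric])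
    also have "\<dots> = \<kappa> T u"
      using right.amap_comp[OF left.amap_hom[OF t] k] k_eq[OF u] by (simp add: \<kappa>_def)
    finally show ?thesis .
  qed
  have "universal_pairing B X (OMap R Z) ?RP e"
    unfolding universal_pairing_def
  proof (intro conjI ballI)
    show "e \<in> hom B (?RP \<otimes>\<^bsub>B\<^esub> X) (OMap R Z)"
      unfolding e_def using \<kappa>_bij[OF RP] id_RP by (rule bij_betwE[THEN bspec])
    show "bij_betw (\<lambda>u. e \<cdot>\<^bsub>B\<^esub> (u \<boxtimes>\<^bsub>B\<^esub> \<one>\<^bsub>B\<^esub> X)) (hom B T ?RP) (hom B (T \<otimes>\<^bsub>B\<^esub> X) (OMap R Z))"
      if "T \<in> Ob B" for T
      using \<kappa>_bij[OF that] by (rule bij_betw_cong[THEN iffD2, rotated]) (rule \<kappa>_eq)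
  qed (rule RP)
  then show ?thesis ..
qed

section \<open>Representability of the presheaf and pre-rigidity of \<open>B\<close>\<close>

theorem proposition2p12:
  fixes A :: "('oa, 'ma, 'x) moncat_scheme" and B :: "('ob, 'mb, 'y) moncat_scheme"
    and L :: "('ob, 'mb, 'oa, 'ma) func" and R :: "('oa, 'ma, 'ob, 'mb) func"
    and \<eta> :: "'ob \<Rightarrow> 'mb" and \<epsilon> :: "'oa \<Rightarrow> 'ma"
    and \<phi> :: "'ob \<Rightarrow> 'ob \<Rightarrow> 'ma" and \<iota> :: "'ma"
  assumes "monoidal_category A" and "monoidal_category B"
    and "adjunction B A L R \<eta> \<epsilon>"
    and "strong_monoidal_functor B A L \<phi> \<iota>"
    and "pre_rigid A"
  shows "(\<forall>X \<in> Ob B. representable B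
            (comp_func (hom_presheaf B (OMap R (OMap L \<I>\<^bsub>B\<^esub>))) (tensor_right B X))) \<and>
         (isomorphic B \<I>\<^bsub>B\<^esub> (OMap R (OMap L \<I>\<^bsub>B\<^esub>)) \<longrightarrow> pre_rigid B) \<and>
         (fully_faithful B A L \<longrightarrow> isomorphic B \<I>\<^bsub>B\<^esub> (OMap R (OMap L \<I>\<^bsub>B\<^esub>)))"
proof -
  interpret adjunction B A L R \<eta> \<epsilon> by fact
  interpret L: strong_monoidal_functor B A L \<phi> \<iota> by fact
  let ?RLI = "OMap R (OMap L \<I>\<^bsub>B\<^esub>)"
  have pairing: "\<exists>P e. universal_pairing B X ?RLI P e" if X: "X \<in> Ob B" for X
  proof -
    obtain P ev where "universal_pairing A (OMap L X) \<I>\<^bsub>A\<^esub> P ev"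
      using \<open>pre_rigid A\<close> left.omap_ob[OF X]
      by (auto simp: pre_rigid_def pre_dual_eq_universal_pairing)
    \<comment> \<open>The isomorphism \<open>\<iota>\<close> moves the target from the unit of
      \<open>A\<close> to \<open>L \<I>\<close>, so that applying \<open>R\<close> gives
      \<open>R L \<I>\<close>.\<close>
    then have "universal_pairing A (OMap L X) (OMap L \<I>\<^bsub>B\<^esub>) P (\<iota> \<cdot>\<^bsub>A\<^esub> ev)"
      by (rule L.target.universal_pairing_iso[OF left.omap_ob[OF X] _ L.unit_hom L.unit_iso])
    then show ?thesis
      using universal_pairing_right_adjoint[OF assms(3,4) X] by blast
  qed
  have "pre_rigid B" if iso: "isomorphic B \<I>\<^bsub>B\<^esub> ?RLI"
  proof -
    obtain f where f: "f \<in> hom B \<I>\<^bsub>B\<^esub> ?RLI" "is_iso B f"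
      using iso by (auto simp: isomorphic_def)
    \<comment> \<open>Pairings are changed by postcomposition, so the isomorphism is needed in the
      direction from \<open>R L \<I>\<close> to \<open>\<I>\<close>.\<close>
    then obtain g where g: "g \<in> hom B ?RLI \<I>\<^bsub>B\<^esub>" "g \<cdot>\<^bsub>B\<^esub> f = \<one>\<^bsub>B\<^esub> \<I>\<^bsub>B\<^esub>"
        "f \<cdot>\<^bsub>B\<^esub> g = \<one>\<^bsub>B\<^esub> ?RLI"
      by (metis is_isoE)
    have "is_iso B g"
      using g(1) f(1) g(3,2) by (rule is_isoI)
    then show ?thesis
      unfolding pre_rigid_def pre_dual_eq_universal_pairing
      using pairing L.source.universal_pairing_iso[OF _ _ g(1)] by blast
  qed
  moreover have "isomorphic B \<I>\<^bsub>B\<^esub> ?RLI" if "fully_faithful B A L"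
    using unit_hom[OF L.source.unit_ob] unit_iso_of_fully_faithful[OF that L.source.unit_ob]
    by (auto simp: isomorphic_def)
  ultimately show ?thesis
    using pairing L.source.representable_of_universal_pairing by blast
qed

end
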